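(* Let $n\ge 1$. For a $231$-avoiding permutation $\sigma\in\mathcal{S}_n(231)$ write $\operatorname{Des}(\sigma)=\{i_1<\dots<i_k\}$ and $\operatorname{iDes}(\sigma)=\{i'_1<\dots<i'_k\}$, and set $i_{k+1}:=n$, $i'_{k+1}:=n$. Let $\Phi(\sigma)$ be the $0/1$-word consisting of $i'_1$ letters $0$, followed by $i_1$ letters $1$, followed by $i'_2-i'_1$ letters $0$, followed by $i_2-i_1$ letters $1$, followed by $i'_3-i'_2$ letters $0$, and so on, ending with $i'_{k+1}-i'_k$ letters $0$ followed by $i_{k+1}-i_k$ letters $1$. Then $\Phi$ is a well-defined map from $\mathcal{S}_n(231)$ to $\mathcal{D}_n$ (that is, $\operatorname{Des}(\sigma)$ and $\operatorname{iDes}(\sigma)$ have the same cardinality and the resulting word is a Dyck path of semilength $n$), and $\Phi:\mathcal{S}_n(231)\to\mathcal{D}_n$ is a bijection.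
   Context: $\mathcal{S}_n$ is the symmetric group on $[n]=\{1,\dots,n\}$, with permutations written $\sigma=[\sigma_1,\dots,\sigma_n]$. A permutation is $231$-avoiding if there are no $i<j<k$ with $\sigma_k<\sigma_i<\sigma_j$; $\mathcal{S}_n(231)$ is the set of $231$-avoiding permutations in $\mathcal{S}_n$. The descent set is $\operatorname{Des}(\sigma)=\{i : 1\le i<n,\ \sigma_i>\sigma_{i+1}\}$, and $\operatorname{iDes}(\sigma):=\operatorname{Des}(\sigma^{-1})$. A Dyck path of semilength $n$ is a word of length $2n$ with $n$ letters $0$ and $n$ letters $1$ such that every prefix contains at least as many $0$'s as $1$'s; $\mathcal{D}_n$ is the set of these. When $k=0$ the word $\Phi(\sigma)$ is $0^n1^n$. *)

theory Defs
  imports "HOL-Combinatorics.Permutations" "HOL-Library.Sublist"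
begin

text \<open>
  An element of the symmetric group on \<open>{1..n}\<close> is a function \<open>\<sigma> :: nat \<Rightarrow> nat\<close> with
  \<open>\<sigma> permutes {1..n}\<close>. Such a function is the identity outside \<open>{1..n}\<close>, so equality of functions
  is equality of permutations, and \<^term>\<open>inv \<sigma>\<close> is the inverse in the symmetric group.
\<close>

definition avoids_231 :: "nat \<Rightarrow> (nat \<Rightarrow> nat) \<Rightarrow> bool" where
  "avoids_231 n \<sigma> \<longleftrightarrow>
     \<not> (\<exists>i\<in>{1..n}. \<exists>j\<in>{1..n}. \<exists>k\<in>{1..n}. i < j \<and> j < k \<and> \<sigma> k < \<sigma> i \<and> \<sigma> i < \<sigma> j)"

definition S231 :: "nat \<Rightarrow> (nat \<Rightarrow> nat) set" where
  "S231 n = {\<sigma>. \<sigma> permutes {1..n} \<and> avoids_231 n \<sigma>}"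

definition Des :: "nat \<Rightarrow> (nat \<Rightarrow> nat) \<Rightarrow> nat set" where
  "Des n \<sigma> = {i. 1 \<le> i \<and> i < n \<and> \<sigma> i > \<sigma> (i + 1)}"

definition iDes :: "nat \<Rightarrow> (nat \<Rightarrow> nat) \<Rightarrow> nat set" where
  "iDes n \<sigma> = Des n (inv \<sigma>)"

definition Dyck :: "nat \<Rightarrow> nat list set" where
  "Dyck n = {w. length w = 2 * n \<and> set w \<subseteq> {0, 1} \<and> count_list w 0 = n \<and> count_list w 1 = n \<and>
                (\<forall>u. prefix u w \<longrightarrow> count_list u 1 \<le> count_list u 0)}"

text \<open>
  For a set \<open>A = {a\<^sub>1 < \<dots> < a\<^sub>k}\<close>, this is the list \<open>[0, a\<^sub>1, \<dots>, a\<^sub>k, n]\<close>. The added leading entry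
  \<open>a\<^sub>0 = 0\<close> makes the first block length \<open>a\<^sub>1\<close> the difference \<open>a\<^sub>1 - a\<^sub>0\<close>.
\<close>

definition breakpoints :: "nat \<Rightarrow> nat set \<Rightarrow> nat list" where
  "breakpoints n A = 0 # sorted_list_of_set A @ [n]"

text \<open>
  The word below is meaningful only if \<^term>\<open>Des n \<sigma>\<close> and \<^term>\<open>iDes n \<sigma>\<close> have the same
  cardinality \<open>k\<close>; then all list indices \<open>j\<close> and \<open>j + 1\<close>, for \<open>j \<le> k\<close>, are in range.
\<close>

definition Phi :: "nat \<Rightarrow> (nat \<Rightarrow> nat) \<Rightarrow> nat list" where
  "Phi n \<sigma> =
     (let d = breakpoints n (Des n \<sigma>); d' = breakpoints n (iDes n \<sigma>)
      in concat (map (\<lambda>j. replicate (d' ! (j + 1) - d' ! j) 0 @ replicate (d ! (j + 1) - d ! j) 1)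
                     [0..<card (Des n \<sigma>) + 1]))"

end

theory Submission
  imports Defs
begin

text \<open>
  The word \<open>\<Phi>(\<sigma>)\<close> has its valleys (factors \<open>10\<close>) exactly after \<open>i'\<^sub>j\<close> letters \<open>0\<close> and \<open>i\<^sub>j\<close> letters \<open>1\<close>,
  for \<open>1 \<le> j \<le> k\<close>. Hence the theorem splits into two bijections.

  A Dyck path of semilength \<open>n\<close> is determined by its valleys, and the valleys may be prescribed by any two
  sets \<open>A = {a\<^sub>1 < \<dots> < a\<^sub>k}\<close> and \<open>A' = {a'\<^sub>1 < \<dots> < a'\<^sub>k}\<close> in \<open>{1..<n}\<close> of equal cardinality with \<open>a\<^sub>j \<le> a'\<^sub>j\<close> for
  all \<open>j\<close>. Equivalently, \<open>A'\<close> never has more elements up to \<open>m\<close> than \<open>A\<close> has. These pairs are the elements of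
  \<open>valley_pairs n\<close>; the bijection is the composition of \<open>bij_betw_corners\<close> and \<open>bij_betw_staircase\<close>.

  It remains to see that \<open>\<sigma> \<mapsto> (Des \<sigma>, iDes \<sigma>)\<close> is a bijection from the \<open>231\<close>-avoiding permutations onto
  \<open>valley_pairs n\<close> (\<open>bij_betw_Des_iDes\<close>). Both sides satisfy the Catalan recursion compatibly. If \<open>a = \<sigma>\<^sub>1\<close>, then
  avoidance forces all values below \<open>a\<close> to precede all values above \<open>a\<close>, so \<open>\<sigma>\<close> is \<open>a\<close>, followed by a
  \<open>231\<close>-avoiding arrangement \<open>\<alpha>\<close> of \<open>{1..a-1}\<close>, followed by a shifted \<open>231\<close>-avoiding arrangement \<open>\<beta>\<close> of \<open>{1..n-a}\<close>
  (\<open>S231_decompose\<close>). Then \<open>Des \<sigma>\<close> consists of \<open>Des \<alpha> + 1\<close>, \<open>Des \<beta> + a\<close> and, if \<open>a > 1\<close>, the position \<open>1\<close>, while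
  \<open>iDes \<sigma>\<close> consists of \<open>iDes \<alpha>\<close>, \<open>iDes \<beta> + a\<close> and, if \<open>a > 1\<close>, the value \<open>a - 1\<close>. The same gluing on pairs of
  sets preserves \<open>valley_pairs\<close>, and \<open>a\<close> can be read off from the glued pair \<open>(A, A')\<close>: it is the least
  \<open>m \<ge> 1\<close> outside \<open>A'\<close> such that \<open>A\<close> and \<open>A'\<close> have equally many elements up to \<open>m\<close> (\<open>glue_valley_pairs\<close>).
  Cutting an arbitrary valley pair at this \<open>m\<close> inverts the gluing (\<open>valley_pairs_decompose\<close>), and strong
  induction on \<open>n\<close> concludes.
\<close>

section \<open>Words with prescribed corners\<close>

text \<open>
  \<open>staircase c ps\<close> is the lattice word that starts at the point \<open>c\<close> and visits the points of \<open>ps\<close> in turn, each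
  reached by a run of \<open>0\<close> and then a run of \<open>1\<close>. A point records the number of letters \<open>0\<close> and the number of
  letters \<open>1\<close> read so far. The points are meant to increase, so that no subtraction truncates.
\<close>

fun staircase :: "nat \<times> nat \<Rightarrow> (nat \<times> nat) list \<Rightarrow> nat list" where
  "staircase c [] = []"
| "staircase c (p # ps) =
     replicate (fst p - fst c) 0 @ replicate (snd p - snd c) 1 @ staircase p ps"

text \<open>Both coordinates increase strictly, so that all runs of the staircase word are nonempty.\<close>

definition strict_chain :: "(nat \<times> nat) list \<Rightarrow> bool" where
  "strict_chain ps = sorted_wrt (\<lambda>p q. fst p < fst q \<and> snd p < snd q) ps"

lemma strict_chain_Cons_Cons [simp]:
  "strict_chain (c # p # ps) \<longleftrightarrow> fst c < fst p \<and> snd c < snd p \<and> strict_chain (p # ps)"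
  unfolding strict_chain_def by (auto dest: less_trans)

lemma staircase_conv_concat:
  "staircase c ps = concat (map (\<lambda>j.
      replicate (fst ((c # ps) ! (j + 1)) - fst ((c # ps) ! j)) 0 @
      replicate (snd ((c # ps) ! (j + 1)) - snd ((c # ps) ! j)) 1) [0..<length ps])"
proof (induction ps arbitrary: c)
  case (Cons p ps)
  have split: "[0..<length (p # ps)] = 0 # map Suc [0..<length ps]"
    by (simp add: upt_conv_Cons map_Suc_upt del: upt_Suc)
  show ?case
    unfolding split staircase.simps(2) Cons.IH[of p] by (simp add: comp_def)
qed simp

lemma staircase_Nil_or_hd:
  assumes "strict_chain (c # ps)"
  shows "staircase c ps = [] \<or> hd (staircase c ps) = 0"
  using assms by (cases ps) (auto simp: hd_append)

lemma count_list_replicate: "count_list (replicate k x) y = (if x = y then k else 0)"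
  by (induction k) auto

lemma takeWhile_replicate_append:
  "takeWhile P (replicate k x @ ys) = (if P x then replicate k x @ takeWhile P ys else if k = 0 then takeWhile P ys else [])"
  by (induction k) auto

lemma replicate_append_eq:
  assumes "replicate k x @ ys = replicate l x @ zs"
    and "ys = [] \<or> hd ys \<noteq> x" "zs = [] \<or> hd zs \<noteq> x"
  shows "k = l \<and> ys = zs"
proof -
  have "takeWhile (\<lambda>y. y = x) ys = []" "takeWhile (\<lambda>y. y = x) zs = []"
    using assms(2,3) by (auto simp: takeWhile_eq_Nil_iff)
  then have "replicate k x = replicate l x"
    using arg_cong[OF assms(1), of "takeWhile (\<lambda>y. y = x)"]
    by (simp add: takeWhile_replicate_append)
  then have "k = l" by (simp add: replicate_eq_replicate)
  with assms(1) show ?thesis by simp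
qed

text \<open>As all runs are nonempty, they are the maximal runs of the word, which therefore determines them.\<close>

lemma staircase_inject:
  assumes "strict_chain (c # ps)" "strict_chain (c # qs)" "staircase c ps = staircase c qs"
  shows "ps = qs"
  using assms
proof (induction ps arbitrary: c qs)
  case Nil
  then show ?case by (cases qs) auto
next
  case (Cons p ps)
  from Cons.prems obtain q qs' where qs: "qs = q # qs'"
    by (cases qs) auto
  have first: "fst c < fst p" "snd c < snd p" "fst c < fst q" "snd c < snd q"
    and rest: "strict_chain (p # ps)" "strict_chain (q # qs')"
    using Cons.prems by (auto simp: qs)
  have tail: "staircase p ps = [] \<or> hd (staircase p ps) \<noteq> 1"
       "staircase q qs' = [] \<or> hd (staircase q qs') \<noteq> 1"
    using rest staircase_Nil_or_hd by fastforce+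
  have "fst p - fst c = fst q - fst c \<and>
      replicate (snd p - snd c) 1 @ staircase p ps = replicate (snd q - snd c) 1 @ staircase q qs'"
    by (rule replicate_append_eq[where x = 0])
       (use Cons.prems first in \<open>auto simp: qs hd_append\<close>)
  moreover from this have "snd p - snd c = snd q - snd c \<and> staircase p ps = staircase q qs'"
    by (intro replicate_append_eq[where x = 1]) (use tail in auto)
  ultimately have "p = q" "staircase p ps = staircase q qs'"
    using first by (auto simp: prod_eq_iff)
  then show ?case using Cons.IH[of p qs'] rest qs by simp
qed

lemma replicate_append_exists: "\<exists>k ys. xs = replicate k x @ ys \<and> (ys = [] \<or> hd ys \<noteq> x)"
proof (induction xs)
  case (Cons y xs)
  then obtain k ys where "xs = replicate k x @ ys \<and> (ys = [] \<or> hd ys \<noteq> x)" by blast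
  then show ?case
    by (cases "y = x") (auto intro: exI[of _ "Suc k"] exI[of _ 0])
qed simp

lemma staircase_surj:
  assumes "set w \<subseteq> {0, 1}" "w = [] \<or> hd w = 0 \<and> last w = 1"
  shows "\<exists>ps. strict_chain (c # ps) \<and> staircase c ps = w \<and>
    last (c # ps) = (fst c + count_list w 0, snd c + count_list w 1)"
  using assms
proof (induction w arbitrary: c rule: length_induct)
  case (1 w)
  show ?case
  proof (cases "w = []")
    case True
    then show ?thesis by (intro exI[of _ "[]"]) (simp add: strict_chain_def)
  next
    case False
    have ends: "hd w = 0" "last w = 1" using "1.prems" False by auto
    obtain k v where k: "w = replicate k 0 @ v" and v0: "v = [] \<or> hd v \<noteq> 0"
      using replicate_append_exists[of w 0] by blast
    obtain l u where l: "v = replicate l 1 @ u" and u1: "u = [] \<or> hd u \<noteq> 1"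
      using replicate_append_exists[of v 1] by blast
    have "v \<noteq> []"
    proof
      assume "v = []"
      then have "set w \<subseteq> {0}" using k by auto
      then show False using ends(2) last_in_set[OF False] by auto
    qed
    with v0 have "hd v \<noteq> 0" by simp
    have "k > 0" using k ends \<open>hd v \<noteq> 0\<close> by (cases k) auto
    have "set v \<subseteq> {0,1}" using "1.prems" k by auto
    then have "hd v = 1" using \<open>hd v \<noteq> 0\<close> subsetD[OF _ hd_in_set[OF \<open>v \<noteq> []\<close>]] by fastforce
    have "l > 0" using l \<open>hd v = 1\<close> \<open>v \<noteq> []\<close> u1 by (cases l) auto
    have "set u \<subseteq> {0,1}" using \<open>set v \<subseteq> _\<close> l by auto
    then have u: "u = [] \<or> hd u = 0 \<and> last u = 1"
      using u1 ends k l subsetD[OF _ hd_in_set[of u], of "{0, 1}"] by (cases "u = []") auto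
    let ?p = "(fst c + k, snd c + l)"
    have "length u < length w" using k l \<open>k > 0\<close> by simp
    then obtain ps where ps: "strict_chain (?p # ps)" "staircase ?p ps = u"
      "last (?p # ps) = (fst ?p + count_list u 0, snd ?p + count_list u 1)"
      using "1.IH" \<open>set u \<subseteq> {0,1}\<close> u by blast
    have "count_list w 0 = k + count_list u 0" "count_list w 1 = l + count_list u 1"
      by (simp_all add: k l count_list_replicate)
    with ps show ?thesis
      by (intro exI[of _ "?p # ps"]) (use \<open>k > 0\<close> \<open>l > 0\<close> k l in auto)
  qed
qed

lemma count_staircase:
  assumes "strict_chain (c # ps)"
  shows "fst c + count_list (staircase c ps) 0 = fst (last (c # ps))"
    and "snd c + count_list (staircase c ps) 1 = snd (last (c # ps))"
proof -
  have "fst c + count_list (staircase c ps) 0 = fst (last (c # ps)) \<and>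
    snd c + count_list (staircase c ps) 1 = snd (last (c # ps))"
    using assms
  proof (induction ps arbitrary: c)
    case (Cons p ps)
    then have "fst c < fst p" "snd c < snd p" by simp_all
    moreover have "fst p + count_list (staircase p ps) 0 = fst (last (p # ps))"
      "snd p + count_list (staircase p ps) 1 = snd (last (p # ps))"
      using Cons by auto
    ultimately show ?case by (simp add: count_list_replicate)
  qed simp
  then show "fst c + count_list (staircase c ps) 0 = fst (last (c # ps))"
    "snd c + count_list (staircase c ps) 1 = snd (last (c # ps))" by auto
qed

lemma prefix_replicate: "prefix u (replicate k x) \<longleftrightarrow> (\<exists>j\<le>k. u = replicate j x)"
proof
  assume u: "prefix u (replicate k x)"
  then have "length u \<le> k" using prefix_length_le by fastforce
  moreover have "u = replicate (length u) x"
    using set_mono_prefix[OF u] by (intro replicate_eqI) auto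
  ultimately show "\<exists>j\<le>k. u = replicate j x" by blast
next
  assume "\<exists>j\<le>k. u = replicate j x"
  then obtain j where "j \<le> k" "u = replicate j x" by blast
  then have "replicate k x = u @ replicate (k - j) x" by (simp flip: replicate_add)
  then show "prefix u (replicate k x)" by (rule prefixI)
qed

text \<open>
  The excess of \<open>0\<close> over \<open>1\<close> is locally minimal at the corners, so the Dyck condition has to be checked only
  there.
\<close>

lemma prefix_count_staircase:
  assumes "strict_chain (c # ps)"
  shows "(\<forall>u. prefix u (staircase c ps) \<longrightarrow> snd c + count_list u 1 \<le> fst c + count_list u 0)
    \<longleftrightarrow> (\<forall>p\<in>set (c # ps). snd p \<le> fst p)"
  using assms
proof (induction ps arbitrary: c)
  case (Cons p ps)
  let ?k = "fst p - fst c" and ?l = "snd p - snd c"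
  let ?ok = "\<lambda>u. snd c + count_list u (1::nat) \<le> fst c + count_list u (0::nat)"
  have lt: "fst c < fst p" "snd c < snd p" and ch: "strict_chain (p # ps)"
    using Cons.prems by auto
  have pre: "prefix u (staircase c (p # ps)) \<longleftrightarrow>
      (\<exists>j\<le>?k. u = replicate j 0) \<or> (\<exists>j\<le>?l. u = replicate ?k 0 @ replicate j 1) \<or>
      (\<exists>v. prefix v (staircase p ps) \<and> u = replicate ?k 0 @ replicate ?l 1 @ v)" for u
    by (auto simp: prefix_append prefix_replicate)
  have "(\<forall>u. prefix u (staircase c (p # ps)) \<longrightarrow> ?ok u) \<longleftrightarrow>
      (\<forall>j\<le>?k. ?ok (replicate j 0)) \<and> (\<forall>j\<le>?l. ?ok (replicate ?k 0 @ replicate j 1)) \<and>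
      (\<forall>v. prefix v (staircase p ps) \<longrightarrow> ?ok (replicate ?k 0 @ replicate ?l 1 @ v))"
    unfolding pre by blast
  also have "(\<forall>j\<le>?k. ?ok (replicate j 0)) \<longleftrightarrow> snd c \<le> fst c"
    by (auto simp: count_list_replicate)
  also have "(\<forall>j\<le>?l. ?ok (replicate ?k 0 @ replicate j 1)) \<longleftrightarrow> snd p \<le> fst p"
    using lt by (auto simp: count_list_replicate dest: spec[of _ ?l])
  also have "(\<forall>v. prefix v (staircase p ps) \<longrightarrow> ?ok (replicate ?k 0 @ replicate ?l 1 @ v))
      \<longleftrightarrow> (\<forall>q\<in>set (p # ps). snd q \<le> fst q)"
    unfolding Cons.IH[OF ch, symmetric] using lt by (simp add: count_list_replicate)
  finally show ?case by auto
qed simp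

lemma bij_betw_staircase:
  assumes "n \<ge> 1"
  shows "bij_betw (staircase (0, 0))
    {ps. ps \<noteq> [] \<and> strict_chain ((0, 0) # ps) \<and> last ps = (n, n) \<and> (\<forall>p\<in>set ps. snd p \<le> fst p)}
    (Dyck n)" (is "bij_betw _ ?C _")
proof (rule bij_betwI')
  fix ps qs assume "ps \<in> ?C" "qs \<in> ?C"
  then show "staircase (0, 0) ps = staircase (0, 0) qs \<longleftrightarrow> ps = qs"
    using staircase_inject by blast
next
  fix ps assume ps: "ps \<in> ?C"
  let ?w = "staircase (0, 0) ps"
  have set: "set (staircase c ps) \<subseteq> {0, 1}" for c and ps :: "(nat \<times> nat) list"
    by (induction ps arbitrary: c) (auto split: if_splits)
  have cnt: "count_list ?w 0 = n" "count_list ?w 1 = n"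
    using count_staircase[of "(0,0)" ps] ps by auto
  have "length ?w = 2 * n"
    using sum_count_set[of ?w "{0, 1}"] set cnt by simp
  moreover have "\<forall>u. prefix u ?w \<longrightarrow> count_list u 1 \<le> count_list u 0"
    using prefix_count_staircase[of "(0,0)" ps] ps by auto
  ultimately show "?w \<in> Dyck n" using set cnt by (simp add: Dyck_def)
next
  fix w assume w: "w \<in> Dyck n"
  then have "w \<noteq> []" and letters: "set w \<subseteq> {0, 1}"
    using assms by (auto simp: Dyck_def)
  have "hd w = 0"
  proof (rule ccontr)
    assume "hd w \<noteq> 0"
    then have "hd w = 1" using subsetD[OF letters hd_in_set[OF \<open>w \<noteq> []\<close>]] by simp
    then have "prefix [1] w" using \<open>w \<noteq> []\<close> by (cases w) auto
    moreover have "\<forall>u. prefix u w \<longrightarrow> count_list u 1 \<le> count_list u 0"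
      using w by (simp add: Dyck_def)
    ultimately have "count_list [1] (1::nat) \<le> count_list [1] (0::nat)" by metis
    then show False by simp
  qed
  moreover have "last w = 1"
  proof (rule ccontr)
    assume "last w \<noteq> 1"
    then have "last w = 0" using subsetD[OF letters last_in_set[OF \<open>w \<noteq> []\<close>]] by simp
    then obtain v where v: "w = v @ [0]"
      using \<open>w \<noteq> []\<close> by (metis append_butlast_last_id)
    have "\<forall>u. prefix u w \<longrightarrow> count_list u 1 \<le> count_list u 0"
      using w by (simp add: Dyck_def)
    then have "count_list v 1 \<le> count_list v 0" using v by (metis prefixI)
    moreover have "count_list w 0 = count_list w 1" using w by (simp add: Dyck_def)
    ultimately show False using v by simp
  qed
  ultimately obtain ps where ps: "strict_chain ((0,0) # ps)" "staircase (0,0) ps = w"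
    "last ((0,0) # ps) = (n, n)"
    using staircase_surj[of w "(0,0)"] w by (auto simp: Dyck_def)
  moreover have "\<forall>p\<in>set ps. snd p \<le> fst p"
    using prefix_count_staircase[OF ps(1)] w ps(2) by (auto simp: Dyck_def)
  moreover have "ps \<noteq> []" using ps(2) \<open>w \<noteq> []\<close> by auto
  ultimately show "\<exists>ps\<in>?C. w = staircase (0, 0) ps" by force
qed

section \<open>Valley pairs\<close>

text \<open>The number of elements of \<open>A\<close> that are at most \<open>m\<close>.\<close>

definition count_upto :: "nat set \<Rightarrow> nat \<Rightarrow> nat" where
  "count_upto A m = card {x \<in> A. x \<le> m}"

text \<open>
  The pairs \<open>(A, A')\<close> of possible coordinate sets of the valleys of a Dyck path of semilength \<open>n\<close>: the numbers
  of letters \<open>1\<close> before the valleys form \<open>A\<close>, the numbers of letters \<open>0\<close> form \<open>A'\<close>. The condition that the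
  \<open>j\<close>-th element of \<open>A\<close> is at most that of \<open>A'\<close> is expressed by counting, which suits the gluing below;
  \<open>count_upto_le_iff_nth_le\<close> translates.
\<close>

definition valley_pairs :: "nat \<Rightarrow> (nat set \<times> nat set) set" where
  "valley_pairs n = {(A, A'). A \<subseteq> {1..<n} \<and> A' \<subseteq> {1..<n} \<and> card A = card A' \<and>
     (\<forall>m. count_upto A' m \<le> count_upto A m)}"

text \<open>The valleys of the path as points, closed off by its end point \<open>(n, n)\<close>.\<close>

definition corners :: "nat \<Rightarrow> nat set \<times> nat set \<Rightarrow> (nat \<times> nat) list" where
  "corners n AA = zip (sorted_list_of_set (snd AA) @ [n]) (sorted_list_of_set (fst AA) @ [n])"

lemma nth_le_iff_length_filter:
  fixes xs :: "nat list"
  assumes "sorted xs" "j < length xs"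
  shows "xs ! j \<le> m \<longleftrightarrow> j < length (filter (\<lambda>x. x \<le> m) xs)"
  using assms
proof (induction xs arbitrary: j)
  case (Cons x xs)
  show ?case
  proof (cases "x \<le> m")
    case True
    then show ?thesis using Cons by (cases j) auto
  next
    case False
    then have "\<forall>y\<in>set (x # xs). \<not> y \<le> m" using Cons.prems(1) by auto
    moreover from this have "filter (\<lambda>x. x \<le> m) (x # xs) = []" by (simp add: filter_empty_conv)
    ultimately show ?thesis using nth_mem[OF Cons.prems(2)] by (metis length_0_conv not_less_zero)
  qed
qed simp

lemma sorted_list_of_set_nth_le_iff:
  assumes "finite A" "j < card A"
  shows "sorted_list_of_set A ! j \<le> m \<longleftrightarrow> j < count_upto A m"
proof -
  let ?xs = "sorted_list_of_set A"
  have "distinct (filter (\<lambda>x. x \<le> m) ?xs)" by simp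
  then have "length (filter (\<lambda>x. x \<le> m) ?xs) = card (set (filter (\<lambda>x. x \<le> m) ?xs))"
    by (rule distinct_card[symmetric])
  also have "\<dots> = count_upto A m"
    using assms(1) by (simp add: count_upto_def)
  finally show ?thesis
    using nth_le_iff_length_filter[of ?xs j m] assms by simp
qed

lemma count_upto_le_iff_nth_le:
  assumes "finite A" "finite B" "card A = card B"
  shows "(\<forall>m. count_upto B m \<le> count_upto A m) \<longleftrightarrow>
    (\<forall>j<card A. sorted_list_of_set A ! j \<le> sorted_list_of_set B ! j)"
proof (intro iffI allI impI)
  fix j assume le: "\<forall>m. count_upto B m \<le> count_upto A m" and j: "j < card A"
  let ?m = "sorted_list_of_set B ! j"
  have "j < count_upto B ?m" using sorted_list_of_set_nth_le_iff[of B j ?m] assms j by simp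
  then have "j < count_upto A ?m" using le le_trans not_le by blast
  then show "sorted_list_of_set A ! j \<le> ?m" using sorted_list_of_set_nth_le_iff assms j by simp
next
  fix m assume le: "\<forall>j<card A. sorted_list_of_set A ! j \<le> sorted_list_of_set B ! j"
  show "count_upto B m \<le> count_upto A m"
  proof (cases "count_upto B m")
    case (Suc j)
    have "count_upto B m \<le> card B" using assms(2) unfolding count_upto_def by (intro card_mono) auto
    then have j: "j < card A" using Suc assms(3) by simp
    have "sorted_list_of_set B ! j \<le> m"
      using sorted_list_of_set_nth_le_iff[of B j m] assms j Suc by simp
    then have "sorted_list_of_set A ! j \<le> m" using le j le_trans by blast
    then show ?thesis using sorted_list_of_set_nth_le_iff[of A j m] assms j Suc by simp
  qed simp
qed

lemma strict_chain_iff: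
  "strict_chain ps \<longleftrightarrow> sorted_wrt (<) (map fst ps) \<and> sorted_wrt (<) (map snd ps)"
  by (auto simp: strict_chain_def sorted_wrt_map sorted_wrt_iff_nth_less)

lemma bij_betw_corners:
  assumes "n \<ge> 1"
  shows "bij_betw (corners n) (valley_pairs n)
    {ps. ps \<noteq> [] \<and> strict_chain ((0, 0) # ps) \<and> last ps = (n, n) \<and> (\<forall>p\<in>set ps. snd p \<le> fst p)}"
    (is "bij_betw _ _ ?C")
proof -
  have fin: "finite A" "finite A'" if "(A, A') \<in> valley_pairs n" for A A'
    using that finite_subset by (auto simp: valley_pairs_def)
  have fst: "map fst (corners n (A, A')) = sorted_list_of_set A' @ [n]"
    and snd: "map snd (corners n (A, A')) = sorted_list_of_set A @ [n]"
    if "card A = card A'" for A A'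
    using that by (simp_all add: corners_def)
  show ?thesis
  proof (rule bij_betwI')
    fix p q assume "p \<in> valley_pairs n" "q \<in> valley_pairs n"
    then obtain A A' B B' where
      pq: "p = (A, A')" "q = (B, B')" "(A, A') \<in> valley_pairs n" "(B, B') \<in> valley_pairs n"
      by (metis surj_pair)
    then have card: "card A = card A'" "card B = card B'" by (auto simp: valley_pairs_def)
    have "A = B \<and> A' = B'" if "corners n p = corners n q"
    proof -
      have "sorted_list_of_set A = sorted_list_of_set B" "sorted_list_of_set A' = sorted_list_of_set B'"
        using fst[OF card(1)] fst[OF card(2)] snd[OF card(1)] snd[OF card(2)] that pq by simp_all
      then show ?thesis using fin[OF pq(3)] fin[OF pq(4)] by (metis sorted_list_of_set_inject)
    qed
    then show "corners n p = corners n q \<longleftrightarrow> p = q" using pq by auto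
  next
    fix p assume "p \<in> valley_pairs n"
    then obtain A A' where p: "p = (A, A')" "(A, A') \<in> valley_pairs n" by (metis surj_pair)
    then have card: "card A = card A'" and sub: "A \<subseteq> {1..<n}" "A' \<subseteq> {1..<n}"
      and le: "\<forall>m. count_upto A' m \<le> count_upto A m" by (auto simp: valley_pairs_def)
    note fin = fin[OF p(2)]
    have "sorted_wrt (<) (0 # sorted_list_of_set B @ [n])" if "B \<subseteq> {1..<n}" "finite B" for B
      using that assms by (auto simp: sorted_wrt_append)
    then have "strict_chain ((0,0) # corners n p)"
      unfolding strict_chain_iff using fst[OF card] snd[OF card] sub fin p by simp
    moreover have "corners n p \<noteq> []" by (simp add: corners_def)
    moreover have "last (corners n p) = (n, n)"
      using card by (simp add: corners_def p)
    moreover have "\<forall>q\<in>set (corners n p). snd q \<le> fst q"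
      using count_upto_le_iff_nth_le[OF fin card] le card
      by (auto simp: corners_def p set_zip nth_append)
    ultimately show "corners n p \<in> ?C" by simp
  next
    fix ps assume ps: "ps \<in> ?C"
    define qs where "qs = butlast ps"
    have split: "ps = qs @ [(n, n)]" using ps by (simp add: qs_def) (metis append_butlast_last_id)
    \<comment> \<open>The final corner \<open>(n, n)\<close> is the end of the path; the earlier corners are its valleys.\<close>
    define A A' where "A = snd ` set qs" and "A' = fst ` set qs"
    have sw: "sorted_wrt (<) (map fst ((0,0) # ps))" "sorted_wrt (<) (map snd ((0,0) # ps))"
      using ps unfolding strict_chain_iff by blast+
    then have sqs: "sorted_wrt (<) (map fst qs)" "sorted_wrt (<) (map snd qs)"
      by (simp_all add: split sorted_wrt_append)
    then have l: "sorted_list_of_set A' = map fst qs" "sorted_list_of_set A = map snd qs"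
      unfolding A_def A'_def
      by (metis list.set_map sorted_list_of_set.idem_if_sorted_distinct strict_sorted_iff)+
    have card: "card A = card A'"
      using l by (metis length_map length_sorted_list_of_set)
    have sub: "A \<subseteq> {1..<n}" "A' \<subseteq> {1..<n}"
      using sw by (force simp: A_def A'_def split sorted_wrt_append)+
    have "\<forall>j<card A. sorted_list_of_set A ! j \<le> sorted_list_of_set A' ! j"
    proof (intro allI impI)
      fix j assume "j < card A"
      then have "j < length qs" using l(2) by (metis length_map length_sorted_list_of_set)
      then have "qs ! j \<in> set ps" by (simp add: split)
      then show "sorted_list_of_set A ! j \<le> sorted_list_of_set A' ! j"
        using ps l \<open>j < length qs\<close> by auto
    qed
    then have "(A, A') \<in> valley_pairs n"
      using sub card count_upto_le_iff_nth_le[of A A'] by (auto simp: valley_pairs_def A_def A'_def)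
    moreover have "ps = corners n (A, A')"
      by (simp add: corners_def l split zip_map_fst_snd)
    ultimately show "\<exists>p\<in>valley_pairs n. ps = corners n p" by blast
  qed
qed

lemma Phi_eq_staircase:
  assumes "card (Des n \<sigma>) = card (iDes n \<sigma>)"
  shows "Phi n \<sigma> = staircase (0, 0) (corners n (Des n \<sigma>, iDes n \<sigma>))"
proof -
  let ?ps = "corners n (Des n \<sigma>, iDes n \<sigma>)"
  have "breakpoints n (iDes n \<sigma>) = map fst ((0, 0) # ?ps)"
    "breakpoints n (Des n \<sigma>) = map snd ((0, 0) # ?ps)"
    using assms by (simp_all add: breakpoints_def corners_def)
  moreover have len: "length ?ps = card (Des n \<sigma>) + 1"
    using assms by (simp add: corners_def)
  ultimately show ?thesis
    unfolding Phi_def Let_def staircase_conv_concat len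
    by (intro arg_cong[of _ _ concat] map_cong refl)
       (simp only: nth_map len list.size atLeast0LessThan set_upt, auto simp: len nth_map[of _ "_ # _"] simp del: list.map)
qed

section \<open>Decomposition of 231-avoiding permutations\<close>

text \<open>
  The permutation in one-line notation: \<open>a\<close>, then \<open>\<alpha>\<close> on \<open>{1..a-1}\<close>, then \<open>\<beta>\<close> shifted by \<open>a\<close>. If \<open>\<beta>\<close> is the
  identity beyond \<open>n - a\<close>, this function is the identity beyond \<open>n\<close>; the value at \<open>0\<close> makes it fix \<open>0\<close> as well.
\<close>

definition glue :: "nat \<Rightarrow> (nat \<Rightarrow> nat) \<Rightarrow> (nat \<Rightarrow> nat) \<Rightarrow> nat \<Rightarrow> nat" where
  "glue a \<alpha> \<beta> x = (if x = 0 then 0 else if x = 1 then a else if x \<le> a then \<alpha> (x - 1) else \<beta> (x - a) + a)"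

text \<open>The inverse of the glued permutation, in terms of the inverses \<open>\<alpha>'\<close> and \<open>\<beta>'\<close> of the parts.\<close>

definition glue_inv :: "nat \<Rightarrow> (nat \<Rightarrow> nat) \<Rightarrow> (nat \<Rightarrow> nat) \<Rightarrow> nat \<Rightarrow> nat" where
  "glue_inv a \<alpha>' \<beta>' y = (if y = 0 then 0 else if y < a then \<alpha>' y + 1 else if y = a then 1 else \<beta>' (y - a) + a)"

lemma permutes_atLeastAtMost_bounds:
  fixes k :: nat
  assumes "p permutes {1..k}"
  shows "0 < y \<Longrightarrow> 0 < p y" "0 < y \<Longrightarrow> y \<le> k \<Longrightarrow> p y \<le> k" "k < y \<Longrightarrow> p y = y"
proof -
  show "0 < p y" if "0 < y"
    using that permutes_in_image[OF assms, of y] permutes_not_in[OF assms, of y]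
    by (cases "y \<in> {1..k}") auto
  show "p y \<le> k" if "0 < y" "y \<le> k"
    using that permutes_in_image[OF assms, of y] by auto
  show "p y = y" if "k < y"
    using that permutes_not_in[OF assms, of y] by auto
qed

lemma glue_permutes:
  assumes "1 \<le> a" "a \<le> n" "\<alpha> permutes {1..a-1}" "\<beta> permutes {1..n-a}"
  shows "glue a \<alpha> \<beta> permutes {1..n}" and "inv (glue a \<alpha> \<beta>) = glue_inv a (inv \<alpha>) (inv \<beta>)"
proof -
  note inv_perm = permutes_inv[OF assms(3)] permutes_inv[OF assms(4)]
  note bounds = permutes_atLeastAtMost_bounds[OF assms(3)] permutes_atLeastAtMost_bounds[OF assms(4)]
    permutes_atLeastAtMost_bounds[OF inv_perm(1)] permutes_atLeastAtMost_bounds[OF inv_perm(2)]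
  note inverses = permutes_inverses[OF assms(3)] permutes_inverses[OF assms(4)]
  have 1: "glue_inv a (inv \<alpha>) (inv \<beta>) (glue a \<alpha> \<beta> x) = x" for x
  proof -
    consider "x = 0" | "x = 1" | "1 < x" "x \<le> a" | "a < x" "1 < x" by linarith
    then show ?thesis
    proof cases
      case 3
      then show ?thesis using bounds(1)[of "x-1"] bounds(2)[of "x-1"]
        by (simp add: glue_def glue_inv_def inverses) linarith
    next
      case 4
      then show ?thesis using bounds(4)[of "x-a"]
        by (simp add: glue_def glue_inv_def inverses)
    qed (use assms in \<open>auto simp: glue_def glue_inv_def\<close>)
  qed
  have 2: "glue a \<alpha> \<beta> (glue_inv a (inv \<alpha>) (inv \<beta>) y) = y" for y
  proof -
    consider "y = 0" | "y = a" | "0 < y" "y < a" | "a < y" by linarith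
    then show ?thesis
    proof cases
      case 3
      then show ?thesis using bounds(7)[of y] bounds(8)[of y]
        by (simp add: glue_def glue_inv_def inverses) linarith
    next
      case 4
      then show ?thesis using bounds(10)[of "y-a"] assms(1)
        by (simp add: glue_def glue_inv_def inverses)
    qed (use assms in \<open>auto simp: glue_def glue_inv_def\<close>)
  qed
  have "glue a \<alpha> \<beta> x = x" if "x \<notin> {1..n}" for x
    using that assms(1,2) bounds(6)[of "x-a"] by (auto simp: glue_def)
  moreover have "bij (glue a \<alpha> \<beta>)"
    by (rule o_bij[of "glue_inv a (inv \<alpha>) (inv \<beta>)"]) (auto simp: fun_eq_iff 1 2)
  ultimately show "glue a \<alpha> \<beta> permutes {1..n}" by (auto simp: permutes_def bij_iff)
  show "inv (glue a \<alpha> \<beta>) = glue_inv a (inv \<alpha>) (inv \<beta>)"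
    using 1 2 by (rule inv_equality)
qed

lemma avoids_231D:
  assumes "avoids_231 n \<sigma>" "i \<in> {1..n}" "j \<in> {1..n}" "k \<in> {1..n}" "i < j" "j < k"
    "\<sigma> k < \<sigma> i" "\<sigma> i < \<sigma> j"
  shows False
  using assms unfolding avoids_231_def by blast

lemma avoids_231I:
  assumes "\<And>i j k. i \<in> {1..n} \<Longrightarrow> j \<in> {1..n} \<Longrightarrow> k \<in> {1..n} \<Longrightarrow> i < j \<Longrightarrow> j < k \<Longrightarrow>
    \<sigma> k < \<sigma> i \<Longrightarrow> \<sigma> i < \<sigma> j \<Longrightarrow> False"
  shows "avoids_231 n \<sigma>"
  using assms unfolding avoids_231_def by blast

lemma glue_in_S231:
  assumes "1 \<le> a" "a \<le> n" "\<alpha> \<in> S231 (a-1)" "\<beta> \<in> S231 (n-a)"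
  shows "glue a \<alpha> \<beta> \<in> S231 n"
proof -
  have \<alpha>: "\<alpha> permutes {1..a-1}" "avoids_231 (a-1) \<alpha>" and \<beta>: "\<beta> permutes {1..n-a}" "avoids_231 (n-a) \<beta>"
    using assms by (auto simp: S231_def)
  let ?g = "glue a \<alpha> \<beta>"
  have low: "?g x \<le> a" if "x \<le> a" for x
    using that permutes_atLeastAtMost_bounds(2)[OF \<alpha>(1), of "x-1"] by (fastforce simp: glue_def)
  have high: "a < ?g x" if "a < x" for x
    using that assms(1) permutes_atLeastAtMost_bounds(1)[OF \<beta>(1), of "x-a"] by (auto simp: glue_def)
  have "avoids_231 n ?g"
  proof (rule avoids_231I)
    fix i j k assume ijk: "i \<in> {1..n}" "j \<in> {1..n}" "k \<in> {1..n}" "i < j" "j < k" "?g k < ?g i" "?g i < ?g j"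
    show False
    proof (cases "i \<le> a")
      case True
      then have "k \<le> a" using low[of i] high[of k] ijk by linarith
      then have "i \<noteq> 1" using low[of j] ijk by (auto simp: glue_def)
      then have "i-1 \<in> {1..a-1}" "j-1 \<in> {1..a-1}" "k-1 \<in> {1..a-1}" "i-1 < j-1" "j-1 < k-1"
        "\<alpha> (k-1) < \<alpha> (i-1)" "\<alpha> (i-1) < \<alpha> (j-1)"
        using ijk \<open>k \<le> a\<close> by (auto simp: glue_def)
      then show False by (rule avoids_231D[OF \<alpha>(2)])
    next
      case False
      then have "i-a \<in> {1..n-a}" "j-a \<in> {1..n-a}" "k-a \<in> {1..n-a}" "i-a < j-a" "j-a < k-a"
        "\<beta> (k-a) < \<beta> (i-a)" "\<beta> (i-a) < \<beta> (j-a)"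
        using ijk assms(1) by (auto simp: glue_def)
      then show False by (rule avoids_231D[OF \<beta>(2)])
    qed
  qed
  then show ?thesis using glue_permutes(1)[OF assms(1,2) \<alpha>(1) \<beta>(1)] by (simp add: S231_def)
qed

lemma S231_decompose:
  assumes "\<sigma> \<in> S231 n" "n \<ge> 1"
  obtains a \<alpha> \<beta> where "1 \<le> a" "a \<le> n" "\<alpha> \<in> S231 (a-1)" "\<beta> \<in> S231 (n-a)" "\<sigma> = glue a \<alpha> \<beta>"
proof -
  have perm: "\<sigma> permutes {1..n}" and av: "avoids_231 n \<sigma>" using assms by (auto simp: S231_def)
  note inj = permutes_inj[OF perm]
  have range: "\<sigma> x \<in> {1..n} \<longleftrightarrow> x \<in> {1..n}" for x by (rule permutes_in_image[OF perm])
  define a where "a = \<sigma> 1"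
  have a: "1 \<le> a" "a \<le> n" using range[of 1] assms(2) by (auto simp: a_def)
  \<comment> \<open>The positions of the values below \<open>a\<close> are downward closed in \<open>{2..n}\<close>, hence form \<open>{2..a}\<close>.\<close>
  define L where "L = {i \<in> {2..n}. \<sigma> i < a}"
  have "\<sigma> ` L = {1..<a}"
  proof
    show "\<sigma> ` L \<subseteq> {1..<a}"
    proof (rule image_subsetI)
      fix x assume "x \<in> L"
      then show "\<sigma> x \<in> {1..<a}" using range[of x] by (simp add: L_def)
    qed
    show "{1..<a} \<subseteq> \<sigma> ` L"
    proof
      fix y assume y: "y \<in> {1..<a}"
      obtain x where x: "y = \<sigma> x" using surjD[OF permutes_surj[OF perm]] by blast
      have "x \<in> {1..n}" using range[of x] x y a by simp
      moreover have "x \<noteq> 1" using x y by (auto simp: a_def)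
      ultimately show "y \<in> \<sigma> ` L" using x y by (auto simp: L_def)
    qed
  qed
  then have card: "card L = a - 1"
    using card_image[OF inj_on_subset[OF inj subset_UNIV], of L] by simp
  have down: "j \<in> L" if "i \<in> L" "2 \<le> j" "j < i" for i j
  proof (rule ccontr)
    assume "j \<notin> L"
    then have "\<not> \<sigma> j < a" using that by (auto simp: L_def)
    moreover have "\<sigma> j \<noteq> a" using inj_eq[OF inj, of j 1] that by (simp add: a_def)
    \<comment> \<open>The positions \<open>1 < j < i\<close> would carry the pattern \<open>231\<close>.\<close>
    ultimately have "\<sigma> i < \<sigma> 1" "\<sigma> 1 < \<sigma> j" using that by (auto simp: L_def a_def)
    moreover have "1 \<in> {1..n}" "j \<in> {1..n}" "i \<in> {1..n}" "1 < j" using that by (auto simp: L_def)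
    ultimately show False using avoids_231D[OF av, of 1 j i] \<open>j < i\<close> by simp
  qed
  have "finite L" by (simp add: L_def)
  have "L \<subseteq> {2..a}"
  proof
    fix x assume "x \<in> L"
    have "{2..x} \<subseteq> L"
    proof
      fix j assume "j \<in> {2..x}"
      then show "j \<in> L" using down[OF \<open>x \<in> L\<close>, of j] \<open>x \<in> L\<close> by (cases "j = x") auto
    qed
    then have "card {2..x} \<le> card L" using \<open>finite L\<close> card_mono by blast
    then show "x \<in> {2..a}" using card \<open>x \<in> L\<close> by (auto simp: L_def)
  qed
  then have L: "L = {2..a}" by (intro card_subset_eq) (auto simp: card)
  have low: "\<sigma> i < a" if "2 \<le> i" "i \<le> a" for i
  proof -
    have "i \<in> L" using that L by simp
    then show ?thesis by (simp add: L_def)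
  qed
  have high: "a < \<sigma> i" if "a < i" "i \<le> n" for i
  proof -
    have "i \<notin> L" using that L by simp
    then have "\<not> \<sigma> i < a" using that a by (auto simp: L_def)
    moreover have "\<sigma> i \<noteq> a" using inj_eq[OF inj, of i 1] that a by (simp add: a_def)
    ultimately show ?thesis by simp
  qed
  define \<alpha> where "\<alpha> x = (if x \<in> {1..a-1} then \<sigma> (x + 1) else x)" for x
  define \<beta> where "\<beta> x = (if x \<in> {1..n-a} then \<sigma> (x + a) - a else x)" for x
  have "inj_on \<alpha> {1..a-1}"
  proof (rule inj_onI)
    fix x y assume "x \<in> {1..a-1}" "y \<in> {1..a-1}" "\<alpha> x = \<alpha> y"
    then have "\<sigma> (x + 1) = \<sigma> (y + 1)" by (simp add: \<alpha>_def)
    then show "x = y" using inj by (auto dest: injD)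
  qed
  moreover have "\<alpha> ` {1..a-1} \<subseteq> {1..a-1}"
  proof (intro image_subsetI)
    fix x assume x: "x \<in> {1..a-1}"
    then have "2 \<le> x + 1" "x + 1 \<le> a" by auto
    then have "\<sigma> (x + 1) < a" "\<sigma> (x + 1) \<in> {1..n}"
      using low[of "x + 1"] range[of "x + 1"] a(2) by simp_all
    then have "\<sigma> (x + 1) \<in> {1..a-1}" unfolding atLeastAtMost_iff by linarith
    then show "\<alpha> x \<in> {1..a-1}" using x by (simp add: \<alpha>_def)
  qed
  ultimately have "\<alpha> permutes {1..a-1}"
    by (intro inj_imp_permutes) (auto simp: \<alpha>_def image_subset_iff)
  moreover have "avoids_231 (a-1) \<alpha>"
  proof (rule avoids_231I)
    fix i j k assume ijk: "i \<in> {1..a-1}" "j \<in> {1..a-1}" "k \<in> {1..a-1}" "i < j" "j < k"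
      "\<alpha> k < \<alpha> i" "\<alpha> i < \<alpha> j"
    then have "i+1 \<in> {1..n}" "j+1 \<in> {1..n}" "k+1 \<in> {1..n}" "i+1 < j+1" "j+1 < k+1"
      "\<sigma> (k+1) < \<sigma> (i+1)" "\<sigma> (i+1) < \<sigma> (j+1)"
      using a by (auto simp: \<alpha>_def)
    then show False by (rule avoids_231D[OF av])
  qed
  ultimately have \<alpha>: "\<alpha> \<in> S231 (a-1)" by (simp add: S231_def)
  have high': "a < \<sigma> (x + a) \<and> \<sigma> (x + a) \<le> n" if "x \<in> {1..n-a}" for x
  proof -
    have "a < x + a" "x + a \<le> n" using that a by auto
    then show ?thesis using high[of "x+a"] range[of "x+a"] by simp
  qed
  have \<beta>_shift: "\<sigma> (x + a) = \<beta> x + a" if "x \<in> {1..n-a}" for x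
    using high'[OF that] that by (simp add: \<beta>_def)
  have "inj_on \<beta> {1..n-a}"
  proof (rule inj_onI)
    fix x y assume xy: "x \<in> {1..n-a}" "y \<in> {1..n-a}" "\<beta> x = \<beta> y"
    then have "\<sigma> (x + a) = \<sigma> (y + a)" by (simp add: \<beta>_shift)
    then show "x = y" using injD[OF inj, of "x + a" "y + a"] by simp
  qed
  moreover have "\<beta> ` {1..n-a} \<subseteq> {1..n-a}"
  proof (rule image_subsetI)
    fix x assume x: "x \<in> {1..n-a}"
    show "\<beta> x \<in> {1..n-a}" using high'[OF x] \<beta>_shift[OF x] by simp linarith
  qed
  ultimately have "\<beta> permutes {1..n-a}"
    by (intro inj_imp_permutes) (auto simp: \<beta>_def image_subset_iff)
  moreover have "avoids_231 (n-a) \<beta>"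
  proof (rule avoids_231I)
    fix i j k assume ijk: "i \<in> {1..n-a}" "j \<in> {1..n-a}" "k \<in> {1..n-a}" "i < j" "j < k"
      "\<beta> k < \<beta> i" "\<beta> i < \<beta> j"
    then have "i+a \<in> {1..n}" "j+a \<in> {1..n}" "k+a \<in> {1..n}" "i+a < j+a" "j+a < k+a"
      "\<sigma> (k+a) < \<sigma> (i+a)" "\<sigma> (i+a) < \<sigma> (j+a)"
      using a by (auto simp: \<beta>_shift simp del: add_Suc_right)
    then show False by (rule avoids_231D[OF av])
  qed
  ultimately have \<beta>: "\<beta> \<in> S231 (n-a)" by (simp add: S231_def)
  have "\<sigma> x = glue a \<alpha> \<beta> x" for x
  proof -
    consider "x = 0" | "x = 1" | "1 < x" "x \<le> a" | "1 < x" "a < x" "x \<le> n" | "n < x" by linarith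
    then show ?thesis
    proof cases
      case 4
      then have "x - a \<in> {1..n-a}" by auto
      then show ?thesis using 4 \<beta>_shift[of "x - a"] by (simp add: glue_def)
    next
      case 5
      then show ?thesis using permutes_not_in[OF perm, of x] a by (auto simp: glue_def \<beta>_def)
    qed (use permutes_not_in[OF perm, of 0] in \<open>auto simp: glue_def \<alpha>_def a_def\<close>)
  qed
  then show ?thesis using that a \<alpha> \<beta> by blast
qed

section \<open>Descent sets of glued permutations\<close>

text \<open>
  The effect of gluing on descent sets. The first entry \<open>a\<close> exceeds the second one precisely if \<open>\<alpha>\<close> is
  nonempty, that is \<open>1 < a\<close>; there is no descent between the block of \<open>\<alpha>\<close> and that of \<open>\<beta>\<close>.
\<close>

definition glue_Des :: "nat \<Rightarrow> nat set \<Rightarrow> nat set \<Rightarrow> nat set" where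
  "glue_Des a C E = {i. i = 1 \<and> 1 < a \<or> 1 < i \<and> i - 1 \<in> C \<or> a < i \<and> i - a \<in> E}"

text \<open>
  The effect on inverse descent sets. Since the value \<open>a\<close> comes first, \<open>a - 1\<close> becomes an inverse
  descent if it is positive, and \<open>a\<close> does not become one.
\<close>

definition glue_iDes :: "nat \<Rightarrow> nat set \<Rightarrow> nat set \<Rightarrow> nat set" where
  "glue_iDes a C E = {i. i \<in> C \<or> 1 < a \<and> i = a - 1 \<or> a < i \<and> i - a \<in> E}"

lemma Des_glue:
  assumes "1 \<le> a" "a \<le> n" "\<alpha> permutes {1..a-1}" "\<beta> permutes {1..n-a}"
  shows "Des n (glue a \<alpha> \<beta>) = glue_Des a (Des (a-1) \<alpha>) (Des (n-a) \<beta>)"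
proof (intro set_eqI)
  fix i
  note bounds = permutes_atLeastAtMost_bounds[OF assms(3)] permutes_atLeastAtMost_bounds[OF assms(4)]
  consider "i = 0" | "i = 1" | "1 < i" "i < a" | "1 < i" "i = a" | "1 < i" "a < i" by linarith
  then show "i \<in> Des n (glue a \<alpha> \<beta>) \<longleftrightarrow> i \<in> glue_Des a (Des (a-1) \<alpha>) (Des (n-a) \<beta>)"
  proof cases
    case 2
    have "\<alpha> 1 < a" if "1 < a" using that bounds(2)[of 1] by force
    then show ?thesis using 2 assms(1,2) bounds(4)[of 1]
      by (cases "a = 1") (auto simp: Des_def glue_Des_def glue_def)
  next
    case 3
    then show ?thesis using assms(1,2) by (auto simp: Des_def glue_Des_def glue_def)
  next
    case 4
    then show ?thesis using assms(1,2) bounds(2)[of "a-1"] by (auto simp: Des_def glue_Des_def glue_def)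
  next
    case 5
    then show ?thesis using assms(1,2) by (auto simp: Des_def glue_Des_def glue_def Suc_diff_le)
  qed (auto simp: Des_def glue_Des_def)
qed

lemma iDes_glue:
  assumes "1 \<le> a" "a \<le> n" "\<alpha> permutes {1..a-1}" "\<beta> permutes {1..n-a}"
  shows "iDes n (glue a \<alpha> \<beta>) = glue_iDes a (iDes (a-1) \<alpha>) (iDes (n-a) \<beta>)"
  unfolding iDes_def glue_permutes(2)[OF assms]
proof (intro set_eqI)
  fix i
  note bounds = permutes_atLeastAtMost_bounds[OF permutes_inv[OF assms(3)]]
    permutes_atLeastAtMost_bounds[OF permutes_inv[OF assms(4)]]
  consider "i = 0" | "0 < i" "i < a - 1" | "0 < i" "i = a - 1" | "0 < i" "i = a" | "a < i" by linarith
  then show "i \<in> Des n (glue_inv a (inv \<alpha>) (inv \<beta>)) \<longleftrightarrow>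
      i \<in> glue_iDes a (Des (a-1) (inv \<alpha>)) (Des (n-a) (inv \<beta>))"
  proof cases
    case 2
    then show ?thesis using assms(1,2) by (auto simp: Des_def glue_iDes_def glue_inv_def)
  next
    case 3
    then show ?thesis using assms(1,2) bounds(1)[of "a-1"] by (auto simp: Des_def glue_iDes_def glue_inv_def)
  next
    case 4
    then show ?thesis using assms(1,2) by (auto simp: Des_def glue_iDes_def glue_inv_def)
  next
    case 5
    then show ?thesis using assms(1,2) by (auto simp: Des_def glue_iDes_def glue_inv_def Suc_diff_le)
  qed (auto simp: Des_def glue_iDes_def)
qed

section \<open>Gluing and cutting valley pairs\<close>

lemma count_upto_Suc: "count_upto A (Suc m) = count_upto A m + of_bool (Suc m \<in> A)"
proof -
  have "{x \<in> A. x \<le> Suc m} = (if Suc m \<in> A then insert (Suc m) {x \<in> A. x \<le> m} else {x \<in> A. x \<le> m})"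
    by (auto simp: le_Suc_eq)
  then show ?thesis by (simp add: count_upto_def)
qed

lemma count_upto_eq_card:
  assumes "A \<subseteq> {1..<k}" "k \<le> Suc m"
  shows "count_upto A m = card A"
proof -
  have "{x \<in> A. x \<le> m} = A" using assms by fastforce
  then show ?thesis by (simp add: count_upto_def)
qed

lemma count_upto_0: "A \<subseteq> {1..<k} \<Longrightarrow> count_upto A 0 = 0"
  by (auto simp: count_upto_def)

lemma card_Un_disjoint3:
  assumes "finite S" "finite T" "finite U" "S \<inter> T = {}" "(S \<union> T) \<inter> U = {}"
  shows "card (S \<union> T \<union> U) = card S + card T + card U"
  using assms card_Un_disjoint[of "S \<union> T" U] card_Un_disjoint[of S T] by simp

text \<open>For \<open>m < a\<close> both sides are false, because truncated subtraction gives \<open>m - a = 0\<close> and \<open>0 \<notin> E\<close>.\<close>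

lemma mem_shift_iff:
  fixes E :: "nat set"
  assumes "E \<subseteq> {1..<k}"
  shows "i \<in> (\<lambda>x. x + a) ` {x \<in> E. x \<le> m - a} \<longleftrightarrow> a < i \<and> i - a \<in> E \<and> i \<le> m"
proof
  assume "i \<in> (\<lambda>x. x + a) ` {x \<in> E. x \<le> m - a}"
  then obtain x where x: "i = x + a" "x \<in> E" "x \<le> m - a" by blast
  moreover have "0 < x" using x(2) assms by auto
  ultimately show "a < i \<and> i - a \<in> E \<and> i \<le> m" by auto
next
  assume "a < i \<and> i - a \<in> E \<and> i \<le> m"
  then show "i \<in> (\<lambda>x. x + a) ` {x \<in> E. x \<le> m - a}"
    by (intro image_eqI[of _ _ "i - a"]) auto
qed

lemma count_upto_glue_Des:
  assumes "1 \<le> a" "C \<subseteq> {1..<a-1}" "E \<subseteq> {1..<k}"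
  shows "count_upto (glue_Des a C E) m =
    of_bool (1 < a \<and> 1 \<le> m) + count_upto C (m - 1) + count_upto E (m - a)"
proof -
  let ?S = "if 1 < a \<and> 1 \<le> m then {1::nat} else {}"
    and ?T = "Suc ` {x \<in> C. x \<le> m - 1}" and ?U = "(\<lambda>x. x + a) ` {x \<in> E. x \<le> m - a}"
  have partition: "{x \<in> glue_Des a C E. x \<le> m} = ?S \<union> ?T \<union> ?U"
  proof (intro set_eqI)
    fix i
    have "0 \<notin> C" using assms(2) by auto
    then have T: "i \<in> ?T \<longleftrightarrow> 1 < i \<and> i - 1 \<in> C \<and> i \<le> m"
      by (cases i; cases "i - 1") (auto simp: image_iff)
    have "i \<in> ?U \<longleftrightarrow> a < i \<and> i - a \<in> E \<and> i \<le> m"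
      by (rule mem_shift_iff[OF assms(3)])
    then show "i \<in> {x \<in> glue_Des a C E. x \<le> m} \<longleftrightarrow> i \<in> ?S \<union> ?T \<union> ?U"
      using T unfolding glue_Des_def by auto
  qed
  have "finite ?S" "finite ?T" "finite ?U" "?S \<inter> ?T = {}" "(?S \<union> ?T) \<inter> ?U = {}"
    using assms by auto
  then have "card (?S \<union> ?T \<union> ?U) = card ?S + card ?T + card ?U"
    by (rule card_Un_disjoint3)
  then have "count_upto (glue_Des a C E) m = card ?S + card ?T + card ?U"
    unfolding count_upto_def partition .
  then show ?thesis by (simp add: count_upto_def card_image)
qed

lemma count_upto_glue_iDes:
  assumes "1 \<le> a" "C \<subseteq> {1..<a-1}" "E \<subseteq> {1..<k}"
  shows "count_upto (glue_iDes a C E) m =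
    of_bool (1 < a \<and> a - 1 \<le> m) + count_upto C m + count_upto E (m - a)"
proof -
  let ?S = "if 1 < a \<and> a - 1 \<le> m then {a - 1} else {}"
    and ?T = "{x \<in> C. x \<le> m}" and ?U = "(\<lambda>x. x + a) ` {x \<in> E. x \<le> m - a}"
  have partition: "{x \<in> glue_iDes a C E. x \<le> m} = ?S \<union> ?T \<union> ?U"
  proof (intro set_eqI)
    fix i
    have "i \<in> ?U \<longleftrightarrow> a < i \<and> i - a \<in> E \<and> i \<le> m"
      by (rule mem_shift_iff[OF assms(3)])
    then show "i \<in> {x \<in> glue_iDes a C E. x \<le> m} \<longleftrightarrow> i \<in> ?S \<union> ?T \<union> ?U"
      unfolding glue_iDes_def by auto
  qed
  have "finite ?S" "finite ?T" "finite ?U" "?S \<inter> ?T = {}" "(?S \<union> ?T) \<inter> ?U = {}"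
    using assms by auto
  then have "card (?S \<union> ?T \<union> ?U) = card ?S + card ?T + card ?U"
    by (rule card_Un_disjoint3)
  then have "count_upto (glue_iDes a C E) m = card ?S + card ?T + card ?U"
    unfolding count_upto_def partition .
  then show ?thesis by (simp add: count_upto_def card_image)
qed

lemma valley_pairsD:
  assumes "(A, A') \<in> valley_pairs n"
  shows "A \<subseteq> {1..<n}" "A' \<subseteq> {1..<n}" "card A = card A'" "count_upto A' m \<le> count_upto A m"
  using assms by (auto simp: valley_pairs_def)

text \<open>
  The first \<open>m\<close> with this property is where a valley pair is to be cut. The exclusion of \<open>A'\<close> is needed: for \<open>4132\<close> one has
  \<open>A = {1, 3}\<close> and \<open>A' = {2, 3}\<close>, where the counts already agree at \<open>2\<close>, but the first entry is \<open>4\<close>.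
\<close>

definition balanced_at :: "nat set \<Rightarrow> nat set \<Rightarrow> nat \<Rightarrow> bool" where
  "balanced_at A A' m \<longleftrightarrow> 1 \<le> m \<and> count_upto A m = count_upto A' m \<and> m \<notin> A'"

lemma glue_valley_pairs:
  assumes a: "1 \<le> a" "a \<le> n" and C: "(C, C') \<in> valley_pairs (a - 1)" and E: "(E, E') \<in> valley_pairs (n - a)"
  shows "(glue_Des a C E, glue_iDes a C' E') \<in> valley_pairs n"
    and "(LEAST m. balanced_at (glue_Des a C E) (glue_iDes a C' E') m) = a"
proof -
  let ?A = "glue_Des a C E" and ?A' = "glue_iDes a C' E'"
  note C = valley_pairsD[OF C] and E = valley_pairsD[OF E]
  note cnt = count_upto_glue_Des[OF a(1) C(1) E(1)] count_upto_glue_iDes[OF a(1) C(2) E(2)]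
  have high: "count_upto ?A m = of_bool (1 < a) + card C + count_upto E (m - a)"
    "count_upto ?A' m = of_bool (1 < a) + card C + count_upto E' (m - a)" if "a \<le> m" for m
    using that a C by (auto simp: cnt count_upto_eq_card)
  have low: "count_upto ?A m = 1 + count_upto C (m - 1)" "count_upto ?A' m = count_upto C' m"
    if "1 \<le> m" "m < a - 1" for m
    using that E by (simp_all add: cnt count_upto_0)
  have sub: "?A \<subseteq> {1..<n}" "?A' \<subseteq> {1..<n}"
    using C(1,2) E(1,2) a by (fastforce simp: glue_Des_def glue_iDes_def)+
  have "card ?A = card ?A'"
  proof -
    have "card ?A = count_upto ?A n" "card ?A' = count_upto ?A' n"
      using sub by (simp_all add: count_upto_eq_card)
    then show ?thesis using high[OF a(2)] E by (simp add: count_upto_eq_card[of _ "n-a"])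
  qed
  moreover have "count_upto ?A' m \<le> count_upto ?A m" for m
  proof -
    consider "m = 0" | "1 \<le> m" "m < a - 1" | "1 \<le> m" "m = a - 1" | "a \<le> m" by linarith
    then show ?thesis
    proof cases
      case 1
      then show ?thesis using sub by (simp add: count_upto_0)
    next
      case 2
      have "count_upto C' m \<le> count_upto C (Suc (m - 1))" using C(4)[of m] 2 by simp
      then show ?thesis using low[OF 2] count_upto_Suc[of C "m - 1"]
        by (cases "Suc (m - 1) \<in> C") simp_all
    next
      case 3
      then show ?thesis using C E by (simp add: cnt count_upto_eq_card count_upto_0)
    next
      case 4
      then show ?thesis using high[OF 4] E(4) by simp
    qed
  qed
  ultimately show "(?A, ?A') \<in> valley_pairs n" using sub by (simp add: valley_pairs_def)
  show "(LEAST m. balanced_at ?A ?A' m) = a"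
  proof (rule Least_equality)
    have "a \<notin> ?A'" using subsetD[OF C(2), of a] a by (auto simp: glue_iDes_def)
    then show "balanced_at ?A ?A' a"
      using high[of a] a E by (simp add: balanced_at_def count_upto_0)
  next
    fix m assume m: "balanced_at ?A ?A' m"
    show "a \<le> m"
    proof (rule ccontr)
      assume "\<not> a \<le> m"
      moreover have "m \<noteq> a - 1" using m by (auto simp: balanced_at_def glue_iDes_def)
      ultimately have "1 \<le> m" "m < a - 1" using m by (auto simp: balanced_at_def)
      moreover have "m \<notin> C'" using m by (auto simp: balanced_at_def glue_iDes_def)
      then have "count_upto C' m = count_upto C' (m - 1)"
        using count_upto_Suc[of C' "m - 1"] \<open>1 \<le> m\<close> by simp
      \<comment> \<open>The descent at position \<open>1\<close> keeps the count of \<open>?A\<close> strictly ahead at \<open>m\<close>.\<close>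
      ultimately show False using low[of m] C(4)[of "m - 1"] m by (simp add: balanced_at_def)
    qed
  qed
qed

lemma glue_Des_inject:
  assumes "C \<subseteq> {1..<a-1}" "C2 \<subseteq> {1..<a-1}" "E \<subseteq> {1..<k}" "E2 \<subseteq> {1..<k}"
    and eq: "glue_Des a C E = glue_Des a C2 E2"
  shows "C = C2 \<and> E = E2"
proof -
  have "C = {x. 1 \<le> x \<and> x + 1 < a \<and> x + 1 \<in> glue_Des a C E}"
    "E = {x. 1 \<le> x \<and> x + a \<in> glue_Des a C E}"
    if "C \<subseteq> {1..<a-1}" "E \<subseteq> {1..<k}" for C E
    using that by (fastforce simp: glue_Des_def)+
  from this[OF assms(1,3)] this[OF assms(2,4)] eq show ?thesis by metis
qed

lemma glue_iDes_inject:
  assumes "C \<subseteq> {1..<a-1}" "C2 \<subseteq> {1..<a-1}" "E \<subseteq> {1..<k}" "E2 \<subseteq> {1..<k}"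
    and eq: "glue_iDes a C E = glue_iDes a C2 E2"
  shows "C = C2 \<and> E = E2"
proof -
  have "C = {x. x < a - 1 \<and> x \<in> glue_iDes a C E}"
    "E = {x. 1 \<le> x \<and> x + a \<in> glue_iDes a C E}"
    if "C \<subseteq> {1..<a-1}" "E \<subseteq> {1..<k}" for C E
    using that by (fastforce simp: glue_iDes_def)+
  from this[OF assms(1,3)] this[OF assms(2,4)] eq show ?thesis by metis
qed

text \<open>
  The cut point \<open>a\<close> is the least balanced index. Minimality yields \<open>1 \<in> A\<close> and \<open>a - 1 \<in> A'\<close> if \<open>1 < a\<close>, and makes
  the counts below \<open>a\<close> strict enough to absorb the shift by one of the left part of \<open>A\<close>.
\<close>

lemma valley_pairs_decompose:
  assumes A: "(A, A') \<in> valley_pairs n" and n: "n \<ge> 1"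
  obtains a C C' E E' where "1 \<le> a" "a \<le> n" "(C, C') \<in> valley_pairs (a - 1)"
    "(E, E') \<in> valley_pairs (n - a)" "A = glue_Des a C E" "A' = glue_iDes a C' E'"
proof -
  note A = valley_pairsD[OF A]
  have "balanced_at A A' n"
    using A n by (auto simp: balanced_at_def count_upto_eq_card[of _ n])
  define a where "a = (LEAST m. balanced_at A A' m)"
  have bal: "balanced_at A A' a" unfolding a_def by (rule LeastI) fact
  have min: "\<not> balanced_at A A' m" if "m < a" for m using that unfolding a_def by (rule not_less_Least)
  have a: "1 \<le> a" "a \<le> n"
    using bal Least_le[of "balanced_at A A'" n] \<open>balanced_at A A' n\<close> by (auto simp: balanced_at_def a_def)
  have "a \<notin> A'" and eq: "count_upto A a = count_upto A' a" using bal by (auto simp: balanced_at_def)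
  have pred: "count_upto X a = count_upto X (a - 1) + of_bool (a \<in> X)" for X
    using count_upto_Suc[of X "a - 1"] a by simp
  \<comment> \<open>Otherwise \<open>A'\<close> would be ahead of \<open>A\<close> at \<open>a - 1\<close>.\<close>
  have "a \<notin> A"
  proof
    assume "a \<in> A"
    then show False using pred[of A] pred[of A'] eq \<open>a \<notin> A'\<close> A(4)[of "a - 1"] by simp
  qed
  have first: "1 \<in> A" if "1 < a"
  proof (rule ccontr)
    assume "1 \<notin> A"
    moreover have "count_upto A 1 = of_bool (1 \<in> A)" "count_upto A' 1 = of_bool (1 \<in> A')"
      using count_upto_Suc[of A 0] count_upto_Suc[of A' 0] A by (simp_all add: count_upto_0)
    ultimately show False using A(4)[of 1] min[OF that] by (auto simp: balanced_at_def)
  qed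
  have last: "a - 1 \<in> A'" if "1 < a"
    using min[of "a - 1"] that pred[of A] pred[of A'] eq \<open>a \<notin> A\<close> \<open>a \<notin> A'\<close>
    by (auto simp: balanced_at_def)
  define C C' E E' where "C = {x. 1 \<le> x \<and> x + 1 < a \<and> x + 1 \<in> A}" and "C' = {x \<in> A'. x < a - 1}"
    and "E = {x. 1 \<le> x \<and> x + a \<in> A}" and "E' = {x. 1 \<le> x \<and> x + a \<in> A'}"
  have sub: "C \<subseteq> {1..<a-1}" "C' \<subseteq> {1..<a-1}" "E \<subseteq> {1..<n-a}" "E' \<subseteq> {1..<n-a}"
    using A(1,2) by (auto simp: C_def C'_def E_def E'_def less_diff_conv)
  have gA: "A = glue_Des a C E"
  proof (intro set_eqI)
    fix i
    consider "i = 0" | "i = 1" | "1 < i" "i < a" | "i = a" | "a < i" by linarith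
    then show "i \<in> A \<longleftrightarrow> i \<in> glue_Des a C E"
      using A(1) a first \<open>a \<notin> A\<close>
      by cases (cases "a = 1"; auto simp: glue_Des_def C_def E_def)+
  qed
  have gA': "A' = glue_iDes a C' E'"
  proof (intro set_eqI)
    fix i
    consider "i < a - 1" | "i = a - 1" "i < a" | "i = a" | "a < i" using a by linarith
    then show "i \<in> A' \<longleftrightarrow> i \<in> glue_iDes a C' E'"
      using A(2) a last \<open>a \<notin> A'\<close> by cases (auto simp: glue_iDes_def C'_def E'_def)
  qed
  note cnt = count_upto_glue_Des[OF a(1) sub(1,3), folded gA] count_upto_glue_iDes[OF a(1) sub(2,4), folded gA']
  have card: "card C = card C'"
    using eq sub a by (simp add: cnt count_upto_eq_card[of _ "a - 1"] count_upto_0)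
  have "count_upto C' m \<le> count_upto C m" for m
  proof -
    consider "m = 0" | "1 \<le> m" "m < a - 1" | "a - 1 \<le> m" by linarith
    then show ?thesis
    proof cases
      case 2
      have "count_upto A' m < count_upto A (Suc m)"
      proof (cases "Suc m \<in> A'")
        case True
        then show ?thesis using A(4)[of "Suc m"] by (simp add: count_upto_Suc)
      next
        case False
        then have "count_upto A' (Suc m) \<noteq> count_upto A (Suc m)"
          using min[of "Suc m"] 2(2) by (fastforce simp: balanced_at_def)
        then show ?thesis using A(4)[of "Suc m"] False by (simp add: count_upto_Suc)
      qed
      moreover have "count_upto A' m = count_upto C' m" "count_upto A (Suc m) = Suc (count_upto C m)"
        using 2 sub by (simp_all add: cnt count_upto_0)
      ultimately show ?thesis by simp
    qed (use sub card in \<open>simp_all add: count_upto_0 count_upto_eq_card\<close>)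
  qed
  then have "(C, C') \<in> valley_pairs (a - 1)" using sub card by (simp add: valley_pairs_def)
  moreover have le: "count_upto E' m \<le> count_upto E m" for m
  proof -
    have "a - 1 \<le> m + a" by simp
    then show ?thesis
      using A(4)[of "m + a"] sub a card by (simp add: cnt count_upto_eq_card[of _ "a - 1"] del: One_nat_def)
  qed
  have "card E = card E'"
  proof -
    have "count_upto A n = count_upto A' n" using A by (simp add: count_upto_eq_card[of _ n])
    moreover have "a - 1 \<le> n" using a by simp
    ultimately show ?thesis
      using sub a card by (simp del: One_nat_def add: cnt count_upto_eq_card[of _ "a - 1"] count_upto_eq_card[of _ "n - a"])
  qed
  then have "(E, E') \<in> valley_pairs (n - a)" using sub le by (simp add: valley_pairs_def)
  ultimately show ?thesis using that a gA gA' by blast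
qed

section \<open>The bijection\<close>

lemma bij_betw_Des_iDes: "bij_betw (\<lambda>\<sigma>. (Des n \<sigma>, iDes n \<sigma>)) (S231 n) (valley_pairs n)"
proof (induction n rule: less_induct)
  case (less n)
  show ?case
  proof (cases "n = 0")
    case True
    have "S231 0 = {id}" by (auto simp: S231_def avoids_231_def)
    moreover have "valley_pairs 0 = {({}, {})}" by (auto simp: valley_pairs_def)
    ultimately show ?thesis using True by (simp add: bij_betw_def Des_def iDes_def)
  next
    case False
    then have n: "n \<ge> 1" by simp
    have maps: "(Des k \<tau>, iDes k \<tau>) \<in> valley_pairs k" if "k < n" "\<tau> \<in> S231 k" for k \<tau>
      using bij_betw_apply[OF less.IH[OF that(1)] that(2)] by simp
    have inj: "\<tau> = \<tau>'"
      if "k < n" "\<tau> \<in> S231 k" "\<tau>' \<in> S231 k" "Des k \<tau> = Des k \<tau>'" "iDes k \<tau> = iDes k \<tau>'" for k \<tau> \<tau>'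
      using bij_betw_imp_inj_on[OF less.IH[OF that(1)]] that(2-) by (auto dest: inj_onD)
    have surj: "\<exists>\<tau>\<in>S231 k. Des k \<tau> = A \<and> iDes k \<tau> = A'" if "k < n" "(A, A') \<in> valley_pairs k" for k A A'
    proof -
      have "(A, A') \<in> (\<lambda>\<sigma>. (Des k \<sigma>, iDes k \<sigma>)) ` S231 k"
        using bij_betw_imp_surj_on[OF less.IH[OF that(1)]] that(2) by simp
      then show ?thesis by auto
    qed
    have glue: "Des n (glue a \<alpha> \<beta>) = glue_Des a (Des (a-1) \<alpha>) (Des (n-a) \<beta>)"
      "iDes n (glue a \<alpha> \<beta>) = glue_iDes a (iDes (a-1) \<alpha>) (iDes (n-a) \<beta>)"
      if "1 \<le> a" "a \<le> n" "\<alpha> \<in> S231 (a-1)" "\<beta> \<in> S231 (n-a)" for a \<alpha> \<beta>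
      using that by (simp_all add: S231_def Des_glue iDes_glue)
    show ?thesis
    proof (rule bij_betwI')
      fix \<sigma> \<sigma>' assume \<sigma>: "\<sigma> \<in> S231 n" and \<sigma>': "\<sigma>' \<in> S231 n"
      show "(Des n \<sigma>, iDes n \<sigma>) = (Des n \<sigma>', iDes n \<sigma>') \<longleftrightarrow> \<sigma> = \<sigma>'"
      proof
        assume eq: "(Des n \<sigma>, iDes n \<sigma>) = (Des n \<sigma>', iDes n \<sigma>')"
        obtain a \<alpha> \<beta> where a: "1 \<le> a" "a \<le> n" "\<alpha> \<in> S231 (a-1)" "\<beta> \<in> S231 (n-a)" "\<sigma> = glue a \<alpha> \<beta>"
          using S231_decompose[OF \<sigma> n] .
        obtain b \<gamma> \<delta> where b: "1 \<le> b" "b \<le> n" "\<gamma> \<in> S231 (b-1)" "\<delta> \<in> S231 (n-b)" "\<sigma>' = glue b \<gamma> \<delta>"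
          using S231_decompose[OF \<sigma>' n] .
        have lt: "a - 1 < n" "n - a < n" "b - 1 < n" "n - b < n" using a b by auto
        note va = maps[OF lt(1) a(3)] maps[OF lt(2) a(4)]
        note vb = maps[OF lt(3) b(3)] maps[OF lt(4) b(4)]
        have "a = b"
          using glue_valley_pairs(2)[OF a(1,2) va] glue_valley_pairs(2)[OF b(1,2) vb]
            glue[OF a(1-4)] glue[OF b(1-4)] a(5) b(5) eq by simp
        note vb = vb[folded this] and b = b[folded this]
        have "glue_Des a (Des (a-1) \<alpha>) (Des (n-a) \<beta>) = glue_Des a (Des (a-1) \<gamma>) (Des (n-a) \<delta>)"
          "glue_iDes a (iDes (a-1) \<alpha>) (iDes (n-a) \<beta>) = glue_iDes a (iDes (a-1) \<gamma>) (iDes (n-a) \<delta>)"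
          using glue[OF a(1-4)] glue[OF b(1-4)] a(5) b(5) eq by simp_all
        note eqs = this
        have "Des (a-1) \<alpha> = Des (a-1) \<gamma> \<and> Des (n-a) \<beta> = Des (n-a) \<delta>"
          by (rule glue_Des_inject[OF valley_pairsD(1)[OF va(1)] valley_pairsD(1)[OF vb(1)]
                valley_pairsD(1)[OF va(2)] valley_pairsD(1)[OF vb(2)] eqs(1)])
        moreover have "iDes (a-1) \<alpha> = iDes (a-1) \<gamma> \<and> iDes (n-a) \<beta> = iDes (n-a) \<delta>"
          by (rule glue_iDes_inject[OF valley_pairsD(2)[OF va(1)] valley_pairsD(2)[OF vb(1)]
                valley_pairsD(2)[OF va(2)] valley_pairsD(2)[OF vb(2)] eqs(2)])
        ultimately have "\<alpha> = \<gamma>" "\<beta> = \<delta>"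
          using inj[OF lt(1) a(3) b(3)] inj[OF lt(2) a(4) b(4)] by simp_all
        then show "\<sigma> = \<sigma>'" using a(5) b(5) by simp
      qed simp
    next
      fix \<sigma> assume "\<sigma> \<in> S231 n"
      then obtain a \<alpha> \<beta> where a: "1 \<le> a" "a \<le> n" "\<alpha> \<in> S231 (a-1)" "\<beta> \<in> S231 (n-a)" "\<sigma> = glue a \<alpha> \<beta>"
        using S231_decompose[OF _ n] by blast
      moreover have "(Des (a-1) \<alpha>, iDes (a-1) \<alpha>) \<in> valley_pairs (a-1)"
        "(Des (n-a) \<beta>, iDes (n-a) \<beta>) \<in> valley_pairs (n-a)"
        using a by (auto intro!: maps)
      ultimately show "(Des n \<sigma>, iDes n \<sigma>) \<in> valley_pairs n"
        using glue_valley_pairs(1) glue[OF a(1-4)] by simp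
    next
      fix p assume "p \<in> valley_pairs n"
      then obtain A A' where p: "p = (A, A')" "(A, A') \<in> valley_pairs n" by (cases p) auto
      obtain a C C' E E' where a: "1 \<le> a" "a \<le> n" "(C, C') \<in> valley_pairs (a - 1)"
        "(E, E') \<in> valley_pairs (n - a)" "A = glue_Des a C E" "A' = glue_iDes a C' E'"
        using valley_pairs_decompose[OF p(2) n] .
      have "a - 1 < n" "n - a < n" using a by auto
      then obtain \<alpha> \<beta> where "\<alpha> \<in> S231 (a-1)" "Des (a-1) \<alpha> = C" "iDes (a-1) \<alpha> = C'"
        "\<beta> \<in> S231 (n-a)" "Des (n-a) \<beta> = E" "iDes (n-a) \<beta> = E'"
        using surj a(3,4) by metis
      then have "glue a \<alpha> \<beta> \<in> S231 n" "p = (Des n (glue a \<alpha> \<beta>), iDes n (glue a \<alpha> \<beta>))"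
        using a p glue by (auto intro: glue_in_S231)
      then show "\<exists>\<sigma>\<in>S231 n. p = (Des n \<sigma>, iDes n \<sigma>)" by blast
    qed
  qed
qed

theorem theorem3p11:
  fixes n :: nat
  assumes "n \<ge> 1"
  shows "(\<forall>\<sigma>\<in>S231 n. card (Des n \<sigma>) = card (iDes n \<sigma>) \<and> Phi n \<sigma> \<in> Dyck n) \<and>
         bij_betw (Phi n) (S231 n) (Dyck n)"
proof -
  have card: "card (Des n \<sigma>) = card (iDes n \<sigma>)" if "\<sigma> \<in> S231 n" for \<sigma>
    using bij_betw_apply[OF bij_betw_Des_iDes that] valley_pairsD(3) by blast
  have "bij_betw (staircase (0, 0) \<circ> corners n \<circ> (\<lambda>\<sigma>. (Des n \<sigma>, iDes n \<sigma>))) (S231 n) (Dyck n)"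
    using bij_betw_Des_iDes bij_betw_corners[OF assms] bij_betw_staircase[OF assms]
    by (intro bij_betw_trans)
  then have "bij_betw (Phi n) (S231 n) (Dyck n)"
    by (rule bij_betw_cong[THEN iffD1, rotated]) (simp add: Phi_eq_staircase card)
  then show ?thesis using card by (blast dest: bij_betw_apply)
qed

end
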